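(* Let $(X,d)$ be a metric space, fix $\lambda>0$ and consider the new metric $d_\lambda(\cdot,\cdot):=\lambda\,d(\cdot,\cdot)$ on $X$. Then for every triple of points $p,q,x\in X$ the angle cones computed with respect to the two metrics $d$ and $d_\lambda$ coincide: $$\boldsymbol{\angle}_{pxq}=\boldsymbol{\angle}^{\lambda}_{pxq},$$ where $\boldsymbol{\angle}_{pxq}$ is the angle cone of $(p,x,q)$ in $(X,d)$ and $\boldsymbol{\angle}^{\lambda}_{pxq}$ is the angle cone of $(p,x,q)$ in $(X,d_\lambda)$.
   Context: The following notions are defined for an arbitrary metric space $(X,d)$. Slope: for $f:X\to\mathbb R$, $|Df|(x):=\limsup_{y\to x}\frac{|f(y)-f(x)|}{d(y,x)}$ if $x$ is not isolated, and $|Df|(x):=0$ if $x$ is isolated. For $f,g:X\to\mathbb R$ with finite slopes, the functions $D^{\pm}f(\nabla g):X\to\mathbb R$ are defined pointwise by $$D^{+}f(\nabla g):=\liminf_{\varepsilon\downarrow0}\frac{|D(g+\varepsilon f)|^2-|Dg|^2}{2\varepsilon},\qquad D^{-}f(\nabla g):=\limsup_{\varepsilon\uparrow0}\frac{|D(g+\varepsilon f)|^2-|Dg|^2}{2\varepsilon}$$ on $\{|Dg|\neq0\}$, and are $0$ by definition on $\{|Dg|=0\}$. Angle cone: for $p,x,q\in X$ let $r_p:=d(p,\cdot)$, $r_q:=d(q,\cdot)$, $c^{\pm}_{pxq}:=D^{\pm}r_p(\nabla r_q)(x)$ (these lie in $[-1,1]$ and $c^-_{pxq}\le c^+_{pxq}$),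 $\angle^-_{pxq}:=\arccos c^+_{pxq}$, $\angle^+_{pxq}:=\arccos c^-_{pxq}$. The angle cone of $(p,x,q)$ is the interval $\boldsymbol{\angle}_{pxq}:=[\angle^-_{pxq},\angle^+_{pxq}]\subset[0,\pi]$. In $(X,d_\lambda)$ all of these objects (distance functions and slopes) are computed using $d_\lambda$ in place of $d$. *)

theory Defs
  imports "HOL-Analysis.Analysis"
begin

context Metric_space
begin

text \<open>The filter \<^term>\<open>atin mtopology x\<close> consists of the punctured neighbourhoods of \<open>x\<close> inside the carrier, so
  values of \<open>f\<close> outside \<open>M\<close> are irrelevant. The limit superior is taken in the extended reals, since
  the slope of an arbitrary function may be infinite.\<close>

definition slope :: "('a \<Rightarrow> real) \<Rightarrow> 'a \<Rightarrow> ereal" where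
  "slope f x =
     (if openin mtopology {x} then 0
      else Limsup (atin mtopology x) (\<lambda>y. ereal (\<bar>f y - f x\<bar> / d y x)))"

text \<open>The functions \<open>D\<^sup>\<plusminus>f(\<nabla>g)\<close>; the arguments are given in the order \<open>f g x\<close>. They are meant only for
  \<open>f\<close>, \<open>g\<close> of finite slope (which includes all distance functions, as these are 1-Lipschitz); then
  the difference quotients are finite, with absolute value at most
  \<open>|Df|(x) |Dg|(x) + |\<epsilon>| |Df|(x)\<^sup>2 / 2\<close>. Hence so is their limit inferior or superior, and the
  conversion to a real number loses nothing.\<close>

definition D_plus :: "('a \<Rightarrow> real) \<Rightarrow> ('a \<Rightarrow> real) \<Rightarrow> 'a \<Rightarrow> real" where
  "D_plus f g x =
     (if slope g x = 0 then 0
      else real_of_ereal (Liminf (at_right 0)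
        (\<lambda>\<epsilon>::real. ((slope (\<lambda>y. g y + \<epsilon> * f y) x)\<^sup>2 - (slope g x)\<^sup>2) / ereal (2 * \<epsilon>))))"

definition D_minus :: "('a \<Rightarrow> real) \<Rightarrow> ('a \<Rightarrow> real) \<Rightarrow> 'a \<Rightarrow> real" where
  "D_minus f g x =
     (if slope g x = 0 then 0
      else real_of_ereal (Limsup (at_left 0)
        (\<lambda>\<epsilon>::real. ((slope (\<lambda>y. g y + \<epsilon> * f y) x)\<^sup>2 - (slope g x)\<^sup>2) / ereal (2 * \<epsilon>))))"

definition c_plus :: "'a \<Rightarrow> 'a \<Rightarrow> 'a \<Rightarrow> real" where
  "c_plus p x q = D_plus (d p) (d q) x"

definition c_minus :: "'a \<Rightarrow> 'a \<Rightarrow> 'a \<Rightarrow> real" where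
  "c_minus p x q = D_minus (d p) (d q) x"

text \<open>Since \<open>arccos\<close> is decreasing, the lower angle comes from \<open>c\<^sup>+\<close> and the upper one from \<open>c\<^sup>-\<close>.\<close>

definition angle_minus :: "'a \<Rightarrow> 'a \<Rightarrow> 'a \<Rightarrow> real" where
  "angle_minus p x q = arccos (c_plus p x q)"

definition angle_plus :: "'a \<Rightarrow> 'a \<Rightarrow> 'a \<Rightarrow> real" where
  "angle_plus p x q = arccos (c_minus p x q)"

definition angle_cone :: "'a \<Rightarrow> 'a \<Rightarrow> 'a \<Rightarrow> real set" where
  "angle_cone p x q = {angle_minus p x q .. angle_plus p x q}"

lemma Metric_space_scale:
  assumes "lam > 0"
  shows "Metric_space M (\<lambda>y z. lam * d y z)"
proof
  fix x y z assume "x \<in> M" "y \<in> M" "z \<in> M"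
  then show "lam * d x z \<le> lam * d x y + lam * d y z"
    using assms triangle by (simp flip: distrib_left)
qed (use assms in \<open>auto simp: commute\<close>)

end

end

theory Submission
  imports Defs
begin

text \<open>The metrics \<open>d\<close> and \<open>\<lambda>d\<close> induce the same topology, and the difference quotient of \<open>\<lambda>f\<close> with
  respect to \<open>\<lambda>d\<close> is that of \<open>f\<close> with respect to \<open>d\<close>. Passing from \<open>d\<close> to \<open>\<lambda>d\<close> also multiplies
  \<open>r\<^sub>p\<close> and \<open>r\<^sub>q\<close>, hence all combinations \<open>r\<^sub>q + \<epsilon> r\<^sub>p\<close>, by \<open>\<lambda>\<close>, so no slope changes.\<close>

context Metric_space
begin

lemma mball_scale:
  assumes "lam > 0"
  shows "Metric_space.mball M (\<lambda>y z. lam * d y z) x (lam * r) = mball x r"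
proof -
  interpret S: Metric_space M "\<lambda>y z. lam * d y z"
    by (rule Metric_space_scale [OF assms])
  show ?thesis
    using assms by (auto simp: S.mball_def mball_def)
qed

text \<open>Balls of either metric are balls of the other with rescaled radius. Hence isolated
  points and punctured neighbourhood filters, on which \<open>slope\<close> depends, agree
  too.\<close>

lemma mtopology_scale:
  assumes "lam > 0"
  shows "Metric_space.mtopology M (\<lambda>y z. lam * d y z) = mtopology"
proof -
  interpret S: Metric_space M "\<lambda>y z. lam * d y z"
    by (rule Metric_space_scale [OF assms])
  have "(\<exists>r>0. S.mball x r \<subseteq> U) \<longleftrightarrow> (\<exists>r>0. mball x r \<subseteq> U)" for x U
  proof
    assume "\<exists>r>0. S.mball x r \<subseteq> U"
    then obtain r where "r > 0" "S.mball x r \<subseteq> U"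
      by blast
    then show "\<exists>r>0. mball x r \<subseteq> U"
      using assms mball_scale [OF assms, of x "r / lam"]
      by (intro exI [of _ "r / lam"]) auto
  next
    assume "\<exists>r>0. mball x r \<subseteq> U"
    then show "\<exists>r>0. S.mball x r \<subseteq> U"
      using assms mball_scale [OF assms, of x] by (metis mult_pos_pos)
  qed
  then show ?thesis
    by (simp add: topology_eq S.openin_mtopology openin_mtopology)
qed

lemma slope_scale:
  assumes "lam > 0"
  shows "Metric_space.slope M (\<lambda>y z. lam * d y z) (\<lambda>y. lam * f y) x = slope f x"
proof -
  interpret S: Metric_space M "\<lambda>y z. lam * d y z"
    by (rule Metric_space_scale [OF assms])
  \<comment> \<open>If \<open>d y x = 0\<close>, both quotients are 0 by the convention for division
    by zero, so the equation holds for every \<open>y\<close>.\<close>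
  have "\<bar>lam * f y - lam * f x\<bar> / (lam * d y x) = \<bar>f y - f x\<bar> / d y x" for y
    using assms by (simp add: abs_mult flip: right_diff_distrib)
  then show ?thesis
    by (simp add: S.slope_def slope_def mtopology_scale [OF assms])
qed

text \<open>This is the form of the perturbed slope that unfolding \<open>D_plus\<close> and
  \<open>D_minus\<close> produces, with \<open>lam\<close> not yet factored out.\<close>

lemma slope_scale_combination:
  assumes "lam > 0"
  shows "Metric_space.slope M (\<lambda>y z. lam * d y z) (\<lambda>y. lam * g y + \<epsilon> * (lam * f y)) x
       = slope (\<lambda>y. g y + \<epsilon> * f y) x"
  using slope_scale [OF assms, of "\<lambda>y. g y + \<epsilon> * f y" x]
  by (simp add: distrib_left mult.left_commute)

text \<open>The parameter \<epsilon> is not rescaled: the difference quotients agree for each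
  \<epsilon>, before any limit is taken.\<close>

lemma D_plus_scale:
  assumes "lam > 0"
  shows "Metric_space.D_plus M (\<lambda>y z. lam * d y z) (\<lambda>y. lam * f y) (\<lambda>y. lam * g y) x
       = D_plus f g x"
  by (simp add: Metric_space.D_plus_def [OF Metric_space_scale [OF assms]] D_plus_def
      slope_scale [OF assms] slope_scale_combination [OF assms])

lemma D_minus_scale:
  assumes "lam > 0"
  shows "Metric_space.D_minus M (\<lambda>y z. lam * d y z) (\<lambda>y. lam * f y) (\<lambda>y. lam * g y) x
       = D_minus f g x"
  by (simp add: Metric_space.D_minus_def [OF Metric_space_scale [OF assms]] D_minus_def
      slope_scale [OF assms] slope_scale_combination [OF assms])

lemma angle_cone_scale:
  assumes "lam > 0"
  shows "Metric_space.angle_cone M (\<lambda>y z. lam * d y z) p x q = angle_cone p x q"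
proof -
  interpret S: Metric_space M "\<lambda>y z. lam * d y z"
    by (rule Metric_space_scale [OF assms])
  \<comment> \<open>The distance functions of the new metric are \<open>lam\<close> times the old
    ones, as the scaling lemmas require.\<close>
  show ?thesis
    by (simp add: S.angle_cone_def S.angle_minus_def S.angle_plus_def S.c_plus_def S.c_minus_def
        angle_cone_def angle_minus_def angle_plus_def c_plus_def c_minus_def
        D_plus_scale [OF assms] D_minus_scale [OF assms])
qed

end

theorem proposition2p11:
  fixes M :: "'a set" and d :: "'a \<Rightarrow> 'a \<Rightarrow> real" and lam :: real and p q x :: 'a
  assumes "Metric_space M d"
    and "lam > 0"
    and "p \<in> M" and "q \<in> M" and "x \<in> M"
  shows "Metric_space.angle_cone M d p x q
       = Metric_space.angle_cone M (\<lambda>y z. lam * d y z) p x q"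
  using Metric_space.angle_cone_scale [OF assms(1,2)] by simp

end
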